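(* Let $C$ be a nonempty closed convex subset of a real Hilbert space $H$ and let $\mathcal{F}:H\to H$. Suppose that: (B1) $\mathcal{F}$ is $k$-strongly pseudo-monotone and $L$-Lipschitz continuous on $H$; (B2) $\lambda\in(0,\frac1L)$; (B3) $0\le\nu<\frac1t-1$, where $t=1-\frac12\min\left\{\frac{(1-\lambda L)^2}{(1+\lambda L)^2},\,2\lambda k\frac{(1-\lambda L)}{(1+\lambda L)^2}\right\}\in(0,1)$; (B4) $0<\alpha<\frac13$. Then the sequence $\{x_n\}$ generated by the linear inertial subgradient extragradient method (described in the context) converges linearly to the unique element $p^*$ of $VI(C,\mathcal{F})$, i.e. there exist constants $M\ge0$ and $q\in(0,1)$ such that $\|x_n-p^*\|\le Mq^n$ for all $n\ge1$.
   Context: Notation. $VI(C,\mathcal{F})=\{x\in C:\langle \mathcal{F}x,y-x\rangle\ge 0\ \text{for all } y\in C\}$. $P_D$ denotes the metric projection of $H$ onto a nonempty closed convex set $D$. $\mathcal{F}$ is $L$-Lipschitz continuous on $H$ if $\|\mathcal{F}x-\mathcal{F}y\|\le L\|x-y\|$ for all $x,y\in H$, where $L>0$. $\mathcal{F}$ is $k$-strongly pseudo-monotone on $H$, with $k>0$, if for all $x,y\in H$, $\langle\mathcal{F}x,y-x\rangle\ge0$ implies $\langle\mathcal{F}y,y-x\rangle\ge k\|y-x\|^2$. (For such Lipschitz $\mathcal{F}$ it is known that $VI(C,\mathcal{F})$ consists of exactly one element.) Linear inertial subgradient extragradient method (constant parameters $\lambda,\nu,\alpha$). Given $x_0,x_1\in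 H$, for $n=1,2,\dots$: Step 1. $w_n=x_n+\nu(x_n-x_{n-1})$, $y_n=P_C(w_n-\lambda\mathcal{F}w_n)$. Step 2. $u_n=P_{T_n}(w_n-\lambda d_n\mathcal{F}y_n)$, where $T_n=\{x\in H:\langle w_n-\lambda\mathcal{F}w_n-y_n,x-y_n\rangle\le0\}$, $\eta_n=w_n-y_n-\lambda(\mathcal{F}w_n-\mathcal{F}y_n)$, $d_n=\frac{\langle w_n-y_n,\eta_n\rangle}{\|\eta_n\|^2}$. Step 3. $x_{n+1}=(1-\alpha)x_n+\alpha u_n$. It is understood that the method generates an infinite sequence with all quantities well defined (i.e. $\eta_n\neq0$ for every $n$). *)

theory Defs
  imports "HOL-Analysis.Analysis"
begin

definition VI :: "'a::real_inner set \<Rightarrow> ('a \<Rightarrow> 'a) \<Rightarrow> 'a set"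
  where "VI C F = {x \<in> C. \<forall>y\<in>C. F x \<bullet> (y - x) \<ge> 0}"

(* The library's closest_point requires a Heine-Borel space, i.e. finite dimension,
   hence this version for arbitrary Hilbert spaces.  It is meaningful only where the
   nearest point exists uniquely, e.g. for D nonempty, closed and convex. *)
definition metric_proj :: "'a::{real_inner,complete_space} set \<Rightarrow> 'a \<Rightarrow> 'a"
  where "metric_proj D x = (THE z. z \<in> D \<and> (\<forall>y\<in>D. dist x z \<le> dist x y))"

definition strongly_pseudo_monotone :: "real \<Rightarrow> ('a::real_inner \<Rightarrow> 'a) \<Rightarrow> bool"
  where "strongly_pseudo_monotone k F \<longleftrightarrow>
    0 < k \<and> (\<forall>x y. F x \<bullet> (y - x) \<ge> 0 \<longrightarrow> F y \<bullet> (y - x) \<ge> k * (norm (y - x))\<^sup>2)"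

(* The method as a relation between its sequences.  Only indices n >= 1 are constrained;
   x 0 and x 1 are the free starting points.  The division in the formula for d n is
   genuine only if eta n is nonzero, which has to be required separately. *)
definition linear_inertial_subgradient_extragradient ::
  "'a::{real_inner,complete_space} set \<Rightarrow> ('a \<Rightarrow> 'a) \<Rightarrow> real \<Rightarrow> real \<Rightarrow> real \<Rightarrow>
   (nat \<Rightarrow> 'a) \<Rightarrow> (nat \<Rightarrow> 'a) \<Rightarrow> (nat \<Rightarrow> 'a) \<Rightarrow> (nat \<Rightarrow> 'a) \<Rightarrow> (nat \<Rightarrow> 'a set) \<Rightarrow>
   (nat \<Rightarrow> 'a) \<Rightarrow> (nat \<Rightarrow> real) \<Rightarrow> bool"
  where "linear_inertial_subgradient_extragradient C F lam nu \<alpha> x w y u T \<eta> d \<longleftrightarrow>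
    (\<forall>n\<ge>1.
       w n = x n + nu *\<^sub>R (x n - x (n - 1)) \<and>
       y n = metric_proj C (w n - lam *\<^sub>R F (w n)) \<and>
       T n = {z. (w n - lam *\<^sub>R F (w n) - y n) \<bullet> (z - y n) \<le> 0} \<and>
       \<eta> n = w n - y n - lam *\<^sub>R (F (w n) - F (y n)) \<and>
       d n = ((w n - y n) \<bullet> \<eta> n) / (norm (\<eta> n))\<^sup>2 \<and>
       u n = metric_proj (T n) (w n - (lam * d n) *\<^sub>R F (y n)) \<and>
       x (n + 1) = (1 - \<alpha>) *\<^sub>R x n + \<alpha> *\<^sub>R u n)"

lemma inertial_parameter_in_unit_interval:
  fixes lam k L t :: real
  assumes "0 < k" "0 < L" "lam \<in> {0<..<1 / L}"
    and "t = 1 - 1/2 * min ((1 - lam * L)\<^sup>2 / (1 + lam * L)\<^sup>2)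
                          (2 * lam * k * ((1 - lam * L) / (1 + lam * L)\<^sup>2))"
  shows "t \<in> {0<..<1}"
proof -
  have l: "0 < lam" "0 < lam * L" "lam * L < 1"
    using assms(2,3) by (auto simp: field_simps)
  let ?a = "(1 - lam * L)\<^sup>2 / (1 + lam * L)\<^sup>2"
  let ?b = "2 * lam * k * ((1 - lam * L) / (1 + lam * L)\<^sup>2)"
  have "0 < ?a" "0 < ?b" using l assms(1) by simp_all
  moreover have "?a < 1"
    using l power_strict_mono[of "1 - lam * L" "1 + lam * L" 2] by simp
  ultimately have "0 < min ?a ?b" "min ?a ?b < 1" by (auto simp: min_less_iff_disj)
  then show ?thesis unfolding assms(4) by simp
qed

end

theory Submission
  imports Defs
begin

text \<open>
  The proof splits into two independent parts: the variational inequality is solvable, with one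
  solution \<open>p\<close>, and the distance of the iterates to \<open>p\<close> decays geometrically.

  \<^emph>\<open>Solvability.\<close> Put \<open>S y = {z. k * \<parallel>y - z\<parallel>\<^sup>2 \<le> F y \<bullet> (y - z)}\<close>. By a Minty type argument a point
  of \<open>C\<close> that lies in \<open>S y\<close> for all \<open>y \<in> C\<close> solves the inequality. Completing the square shows
  that \<open>S y\<close> is a closed ball, so by weak compactness it suffices that finitely many sets
  \<open>C \<inter> S y\<close> have a common point. Read contrapositively, strong pseudo-monotonicity says that
  \<open>x \<notin> S y\<close> implies \<open>F x \<bullet> (y - x) < 0\<close>; this cannot hold for all \<open>y\<close> in a finite set \<open>J\<close> whose
  convex hull contains \<open>x\<close>. Thus the convex hull of \<open>J\<close> is covered by the balls \<open>S y\<close> with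
  \<open>y \<in> J\<close>, which is the hypothesis of the Knaster-Kuratowski-Mazurkiewicz principle. Since the sets
  are convex, that principle needs no fixed point theorem: it follows from Klee's theorem on convex
  sets with convex union, which is an induction over hyperplane slices (lemmas
  \<open>Klee_intersection\<close>, \<open>convex_KKM\<close>, \<open>bounded_convex_finite_intersection_property\<close> and
  \<open>VI_singleton\<close>).

  \<^emph>\<open>Convergence.\<close> One subgradient extragradient step from \<open>w\<close> to \<open>u\<close> satisfies
  \<open>\<parallel>u - p\<parallel>\<^sup>2 \<le> t * \<parallel>w - p\<parallel>\<^sup>2\<close> (lemma \<open>subgradient_extragradient_step_contracts\<close>). The
  inertial extrapolation that produces \<open>w\<close> costs a factor \<open>1 + nu\<close>, which \<open>t * (1 + nu) < 1\<close>
  absorbs, and a multiple of \<open>\<parallel>x n - x (n - 1)\<parallel>\<^sup>2\<close>, which the relaxation step pays for in the next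
  iterate. Hence the energy \<open>\<parallel>x n - p\<parallel>\<^sup>2 + 2 * \<parallel>x n - x (n - 1)\<parallel>\<^sup>2\<close> decays by a constant factor
  (lemma \<open>inertial_relaxation_energy_decay\<close>), and the distance by the square root of that factor.
\<close>

section \<open>Nearest points in a Hilbert space\<close>

text \<open>The completeness arguments below bound squared distances by the defect of each of the two points
  from an optimal value.\<close>

lemma Cauchy_if_dist_sq_le:
  fixes s :: "nat \<Rightarrow> 'a::metric_space"
  assumes e: "e \<longlonglongrightarrow> 0" and le: "\<And>i j. (dist (s i) (s j))\<^sup>2 \<le> e i + e j"
  shows "Cauchy s"
proof (rule metric_CauchyI)
  fix r :: real assume r: "0 < r"
  then have "\<forall>\<^sub>F n in sequentially. e n < r\<^sup>2 / 2"
    using e by (intro order_tendstoD) auto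
  then obtain N where N: "\<And>n. n \<ge> N \<Longrightarrow> e n < r\<^sup>2 / 2"
    by (auto simp: eventually_sequentially)
  have "dist (s i) (s j) < r" if "i \<ge> N" "j \<ge> N" for i j
  proof (rule power2_less_imp_less)
    show "(dist (s i) (s j))\<^sup>2 < r\<^sup>2"
      using le[of i j] N[OF that(1)] N[OF that(2)] by linarith
  qed (use r in simp)
  then show "\<exists>N. \<forall>m\<ge>N. \<forall>n\<ge>N. dist (s m) (s n) < r" by blast
qed

lemma parallelogram_midpoint:
  fixes a b x :: "'a::real_inner"
  shows "(dist a b)\<^sup>2 = 2 * (dist x a)\<^sup>2 + 2 * (dist x b)\<^sup>2 - 4 * (dist x ((1/2) *\<^sub>R a + (1/2) *\<^sub>R b))\<^sup>2"
  unfolding dist_norm power2_norm_eq_inner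
  by (simp add: algebra_simps inner_simps inner_commute)

text \<open>By the parallelogram law minimizing sequences are Cauchy, because the midpoint of two points of
  \<open>D\<close> is no closer to \<open>x\<close> than the infimum. Completeness replaces the compactness of bounded closed
  sets, which fails in infinite dimension.\<close>

lemma nearest_point_exists:
  fixes D :: "'a::{real_inner,complete_space} set"
  assumes "closed D" "convex D" "D \<noteq> {}"
  obtains z where "z \<in> D" "\<forall>y\<in>D. dist x z \<le> dist x y"
proof -
  define \<delta> where "\<delta> = infdist x D"
  have "\<exists>a\<in>D. dist x a < \<delta> + 1 / real (Suc n)" for n
    using cInf_lessD[of "dist x ` D" "\<delta> + 1 / real (Suc n)"] assms(3) by (auto simp: \<delta>_def infdist_def)
  then obtain a where aD: "\<And>n. a n \<in> D" and a: "\<And>n. dist x (a n) < \<delta> + 1 / real (Suc n)"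
    by metis
  have \<delta>: "0 \<le> \<delta>" "\<And>y. y \<in> D \<Longrightarrow> \<delta> \<le> dist x y"
    unfolding \<delta>_def by (auto simp: infdist_nonneg infdist_le)
  define e where "e n = 2 * ((\<delta> + 1 / real (Suc n))\<^sup>2 - \<delta>\<^sup>2)" for n
  have "e \<longlonglongrightarrow> 2 * ((\<delta> + 0)\<^sup>2 - \<delta>\<^sup>2)"
    unfolding e_def using LIMSEQ_inverse_real_of_nat
    by (intro tendsto_intros) (simp add: inverse_eq_divide)
  moreover have "(dist (a i) (a j))\<^sup>2 \<le> e i + e j" for i j
  proof -
    have "(1/2) *\<^sub>R a i + (1/2) *\<^sub>R a j \<in> D"
      using convexD[OF assms(2) aD[of i] aD[of j], of "1/2" "1/2"] by simp
    then have "\<delta>\<^sup>2 \<le> (dist x ((1/2) *\<^sub>R a i + (1/2) *\<^sub>R a j))\<^sup>2"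
      using \<delta> by (intro power_mono) auto
    moreover have "(dist x (a n))\<^sup>2 \<le> (\<delta> + 1 / real (Suc n))\<^sup>2" for n
      using a[of n] by (intro power_mono) auto
    ultimately show ?thesis
      using parallelogram_midpoint[of "a i" "a j" x]
      unfolding e_def by (smt (verit))
  qed
  ultimately have "Cauchy a" by (intro Cauchy_if_dist_sq_le[of e]) auto
  then obtain z where z: "a \<longlonglongrightarrow> z" using Cauchy_convergent convergent_def by blast
  then have "z \<in> D" using assms(1) aD closed_sequentially by blast
  moreover have "dist x z \<le> \<delta> + 0"
  proof (rule LIMSEQ_le)
    show "(\<lambda>n. dist x (a n)) \<longlonglongrightarrow> dist x z" using z by (intro tendsto_intros)
    show "(\<lambda>n. \<delta> + 1 / real (Suc n)) \<longlonglongrightarrow> \<delta> + 0"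
      using LIMSEQ_inverse_real_of_nat
      by (intro tendsto_intros) (simp add: inverse_eq_divide)
    show "\<exists>N. \<forall>n\<ge>N. dist x (a n) \<le> \<delta> + 1 / real (Suc n)" using a less_imp_le by blast
  qed
  ultimately show thesis using that \<delta>(2) by fastforce
qed

lemma metric_proj_variational:
  fixes D :: "'a::{real_inner,complete_space} set"
  assumes "closed D" "convex D" "D \<noteq> {}"
  shows "metric_proj D x \<in> D"
    and "\<And>y. y \<in> D \<Longrightarrow> (x - metric_proj D x) \<bullet> (y - metric_proj D x) \<le> 0"
proof -
  obtain z where z: "z \<in> D" "\<forall>y\<in>D. dist x z \<le> dist x y"
    using nearest_point_exists[OF assms] by blast
  have "metric_proj D x = z"
    unfolding metric_proj_def
    using z any_closest_point_unique[OF assms(2,1)] by (intro the_equality) auto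
  then show "metric_proj D x \<in> D"
    and "\<And>y. y \<in> D \<Longrightarrow> (x - metric_proj D x) \<bullet> (y - metric_proj D x) \<le> 0"
    using z any_closest_point_dot[OF assms(2,1)] by auto
qed

section \<open>Intersections of convex sets\<close>

text \<open>This is the weak compactness of bounded closed convex sets, reached through points of least norm.
  Enlarging a finite subfamily can only increase the norm of the least point of its intersection, and
  the squared distance moved is at most the increase of the squared norm. The norms are bounded, so
  subfamilies whose norm is nearly the supremum have nearly the same least point, and adding one more
  member of the family hardly moves it.\<close>

lemma bounded_convex_finite_intersection_property:
  fixes \<K> :: "'a::{real_inner,complete_space} set set"
  assumes closed: "\<And>K. K \<in> \<K> \<Longrightarrow> closed K" and convex: "\<And>K. K \<in> \<K> \<Longrightarrow> convex K"
    and B: "B \<in> \<K>" "bounded B"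
    and fip: "\<And>\<F>. finite \<F> \<Longrightarrow> \<F> \<subseteq> \<K> \<Longrightarrow> \<Inter>\<F> \<noteq> {}"
  shows "\<Inter>\<K> \<noteq> {}"
proof -
  \<comment> \<open>Keeping \<open>B\<close> in every subfamily bounds the norms of all least points.\<close>
  define \<A> where "\<A> = {\<F>. finite \<F> \<and> \<F> \<subseteq> \<K> \<and> B \<in> \<F>}"
  have insert: "insert K \<F> \<in> \<A>" if "K \<in> \<K>" "\<F> \<in> \<A>" for K \<F>
    using that by (auto simp: \<A>_def)
  have Un: "\<F> \<union> \<G> \<in> \<A>" if "\<F> \<in> \<A>" "\<G> \<in> \<A>" for \<F> \<G>
    using that by (auto simp: \<A>_def)
  have cc: "closed (\<Inter>\<F>)" "convex (\<Inter>\<F>)" if "\<F> \<in> \<A>" for \<F>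
    using that closed convex by (auto simp: \<A>_def intro!: closed_Inter convex_Inter)
  have "\<exists>z\<in>\<Inter>\<F>. \<forall>y\<in>\<Inter>\<F>. dist 0 z \<le> dist 0 y" if "\<F> \<in> \<A>" for \<F>
  proof -
    have "\<Inter>\<F> \<noteq> {}" using that fip by (auto simp: \<A>_def)
    then show ?thesis using nearest_point_exists[OF cc[OF that], of 0] by blast
  qed
  then obtain m where m: "\<And>\<F>. \<F> \<in> \<A> \<Longrightarrow> m \<F> \<in> \<Inter>\<F>"
    and min: "\<And>\<F>. \<F> \<in> \<A> \<Longrightarrow> \<forall>y\<in>\<Inter>\<F>. dist 0 (m \<F>) \<le> dist 0 y"
    by metis
  have gap: "(dist (m \<F>) (m \<G>))\<^sup>2 \<le> (norm (m \<G>))\<^sup>2 - (norm (m \<F>))\<^sup>2"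
    if "\<F> \<in> \<A>" "\<G> \<in> \<A>" "\<F> \<subseteq> \<G>" for \<F> \<G>
  proof -
    have "m \<G> \<in> \<Inter>\<F>" using m[OF that(2)] that(3) by blast
    from any_closest_point_dot[OF cc(2,1)[OF that(1)] m[OF that(1)] this min[OF that(1)]]
    show ?thesis unfolding dist_norm power2_norm_eq_inner
      by (simp add: algebra_simps inner_simps inner_commute)
  qed
  obtain R where R: "\<And>z. z \<in> B \<Longrightarrow> norm z \<le> R" using B(2) bounded_iff by blast
  define N where "N = (\<lambda>\<F>. (norm (m \<F>))\<^sup>2) ` \<A>"
  have "{B} \<in> \<A>" using B by (auto simp: \<A>_def)
  then have ne: "N \<noteq> {}" by (auto simp: N_def)
  have "norm (m \<F>) \<le> R" if "\<F> \<in> \<A>" for \<F>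
    using m[OF that] that R by (auto simp: \<A>_def)
  then have bdd: "bdd_above N"
    unfolding N_def by (intro bdd_aboveI[of _ "R\<^sup>2"]) (auto intro: power_mono)
  define s where "s = Sup N"
  have s: "(norm (m \<F>))\<^sup>2 \<le> s" if "\<F> \<in> \<A>" for \<F>
    unfolding s_def using that bdd by (intro cSup_upper) (auto simp: N_def)
  have "\<exists>\<F>\<in>\<A>. s - 1 / real (Suc n) < (norm (m \<F>))\<^sup>2" for n
    using less_cSupD[OF ne, of "s - 1 / real (Suc n)"] by (auto simp: s_def N_def)
  then obtain \<F> where \<F>: "\<And>n. \<F> n \<in> \<A>" and s': "\<And>n. s - 1 / real (Suc n) < (norm (m (\<F> n)))\<^sup>2"
    by metis
  have near: "(dist (m (\<F> n)) (m \<G>))\<^sup>2 \<le> 1 / real (Suc n)" if "\<G> \<in> \<A>" "\<F> n \<subseteq> \<G>" for n \<G>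
    using gap[OF \<F> that] s[OF that(1)] s'[of n] by linarith
  have lim: "(\<lambda>n. c * (1 / real (Suc n))) \<longlonglongrightarrow> 0" for c
    using tendsto_mult_right_zero[OF LIMSEQ_inverse_real_of_nat, of c] by (simp add: inverse_eq_divide)
  have "(dist (m (\<F> i)) (m (\<F> j)))\<^sup>2 \<le> 2 * (1 / real (Suc i)) + 2 * (1 / real (Suc j))" for i j
  proof -
    let ?z = "m (\<F> i \<union> \<F> j)"
    have "(dist (m (\<F> i)) (m (\<F> j)))\<^sup>2 \<le> 2 * (dist (m (\<F> i)) ?z)\<^sup>2 + 2 * (dist (m (\<F> j)) ?z)\<^sup>2"
      using parallelogram_midpoint[of "m (\<F> i)" "m (\<F> j)" ?z] by (simp add: dist_commute)
    with near[OF Un[OF \<F> \<F>], of i i j] near[OF Un[OF \<F> \<F>], of j i j] show ?thesis by auto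
  qed
  then have "Cauchy (\<lambda>n. m (\<F> n))" by (rule Cauchy_if_dist_sq_le[OF lim])
  then obtain z where z: "(\<lambda>n. m (\<F> n)) \<longlonglongrightarrow> z" using Cauchy_convergent convergent_def by blast
  \<comment> \<open>The least points after adding \<open>K\<close> lie in \<open>K\<close> and still converge to \<open>z\<close>.\<close>
  have "z \<in> K" if K: "K \<in> \<K>" for K
  proof -
    let ?w = "\<lambda>n. m (insert K (\<F> n))"
    have "(\<lambda>n. (dist (m (\<F> n)) (?w n))\<^sup>2) \<longlonglongrightarrow> 0"
    proof (rule tendsto_sandwich[OF _ _ tendsto_const lim[of 1]])
      show "\<forall>\<^sub>F n in sequentially. (dist (m (\<F> n)) (?w n))\<^sup>2 \<le> 1 * (1 / real (Suc n))"
        using near[OF insert[OF K \<F>]] by (auto intro: always_eventually)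
    qed simp
    then have "(\<lambda>n. dist (m (\<F> n)) (?w n)) \<longlonglongrightarrow> 0" by simp
    then have "(\<lambda>n. m (\<F> n) - ?w n) \<longlonglongrightarrow> 0"
      unfolding dist_norm by (rule tendsto_norm_zero_cancel)
    from tendsto_diff[OF z this] have "?w \<longlonglongrightarrow> z" by simp
    moreover have "?w n \<in> K" for n using m[OF insert[OF K \<F>]] by blast
    ultimately show ?thesis using closed_sequentially[OF closed[OF K], of ?w z] by simp
  qed
  then show ?thesis by blast
qed

text \<open>The mid-hyperplane between two points of \<open>A\<close> and \<open>B\<close> at minimal distance separates the sets.
  Compactness of both provides such a pair in any inner product space.\<close>

lemma separate_compact_convex:
  fixes A B :: "'a::real_inner set"
  assumes A: "compact A" "convex A" "A \<noteq> {}" and B: "compact B" "convex B" "B \<noteq> {}"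
    and disj: "A \<inter> B = {}"
  obtains c \<beta> where "\<And>x. x \<in> A \<Longrightarrow> c \<bullet> x < \<beta>" "\<And>x. x \<in> B \<Longrightarrow> \<beta> < c \<bullet> x"
proof -
  have "\<exists>z\<in>A \<times> B. \<forall>z'\<in>A \<times> B. dist (fst z) (snd z) \<le> dist (fst z') (snd z')"
    using A B by (intro continuous_attains_inf compact_Times continuous_intros) auto
  then obtain a b where ab: "a \<in> A" "b \<in> B"
    and min: "\<And>x y. x \<in> A \<Longrightarrow> y \<in> B \<Longrightarrow> dist a b \<le> dist x y" by auto
  have 1: "(b - a) \<bullet> (x - a) \<le> 0" if "x \<in> A" for x
    using min ab that A compact_imp_closed
    by (intro any_closest_point_dot[of A]) (auto simp: dist_commute)
  have 2: "(a - b) \<bullet> (x - b) \<le> 0" if "x \<in> B" for x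
    using min ab that B compact_imp_closed
    by (intro any_closest_point_dot[of B]) auto
  have 3: "0 < (b - a) \<bullet> (b - a)" using ab disj by auto
  show thesis
  proof (rule that[of "b - a" "((b - a) \<bullet> a + (b - a) \<bullet> b) / 2"])
    fix x assume "x \<in> A"
    from 1[OF this] 3 show "(b - a) \<bullet> x < ((b - a) \<bullet> a + (b - a) \<bullet> b) / 2"
      by (simp add: inner_diff_right field_simps)
  next
    fix x assume "x \<in> B"
    from 2[OF this] 3 show "((b - a) \<bullet> a + (b - a) \<bullet> b) / 2 < (b - a) \<bullet> x"
      by (simp add: inner_simps field_simps)
  qed
qed

text \<open>Suppose that there is no common point. Then a hyperplane \<open>h\<close> strictly separates one of the sets,
  \<open>S m\<close>, from the intersection \<open>A\<close> of the others. The slices of the other sets by \<open>h\<close> again satisfy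
  the hypotheses: they cover the slice of the union, as \<open>S m\<close> misses \<open>h\<close>, and if one of them is left
  out, the intersection of the remaining sets is convex and reaches both \<open>A\<close> and \<open>S m\<close>, so it crosses \<open>h\<close>. By
  induction the slices have a common point, which lies in \<open>A\<close> and on \<open>h\<close>: a contradiction.\<close>

lemma Klee_intersection:
  fixes S :: "'i \<Rightarrow> 'a::real_inner set"
  assumes "finite I" "I \<noteq> {}"
    and "\<And>i. i \<in> I \<Longrightarrow> compact (S i)" "\<And>i. i \<in> I \<Longrightarrow> convex (S i)"
    and "convex (\<Union>i\<in>I. S i)" "(\<Union>i\<in>I. S i) \<noteq> {}"
    and "\<And>i. i \<in> I \<Longrightarrow> (\<Inter>j\<in>I - {i}. S j) \<noteq> {}"
  shows "(\<Inter>i\<in>I. S i) \<noteq> {}"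
  using assms
proof (induction I arbitrary: S rule: finite_ne_induct)
  case (singleton i)
  then show ?case by simp
next
  case (insert m I)
  define A where "A = (\<Inter>i\<in>I. S i)"
  have "insert m I - {m} = I" using insert.hyps by auto
  then have Ane: "A \<noteq> {}" using insert.prems(5)[of m] by (simp add: A_def)
  have A: "compact A" "convex A"
  proof -
    show "compact A" unfolding A_def
    proof -
      obtain i where i: "i \<in> I" using insert.hyps(2) by blast
      then have "(\<Inter>i\<in>I. S i) = S i \<inter> (\<Inter>i\<in>I. S i)" by blast
      moreover have "compact \<dots>"
        using insert.prems(1) i by (intro compact_Int_closed closed_INT) (auto intro: compact_imp_closed)
      ultimately show "compact (\<Inter>i\<in>I. S i)" by simp
    qed
    show "convex A" unfolding A_def using insert.prems(2) by (intro convex_INT) auto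
  qed
  have meets: "\<exists>p. p \<in> S m \<and> p \<in> (\<Inter>j\<in>I - {i}. S j)" if "i \<in> I" for i
  proof -
    have "i \<noteq> m" using that insert.hyps by auto
    then show ?thesis using insert.prems(5)[of i] that by auto
  qed
  show ?case
  proof (rule ccontr)
    assume "\<not> ?thesis"
    then have disj: "A \<inter> S m = {}" by (auto simp: A_def)
    have "S m \<noteq> {}" using meets insert.hyps(2) by blast
    then obtain c \<beta> where c: "\<And>x. x \<in> A \<Longrightarrow> c \<bullet> x < \<beta>" "\<And>x. x \<in> S m \<Longrightarrow> \<beta> < c \<bullet> x"
      using separate_compact_convex[OF A Ane _ _ _ disj] insert.prems(1,2) by auto
    define h where "h = {x. c \<bullet> x = \<beta>}"
    have h: "closed h" "convex h" unfolding h_def by (auto simp: closed_hyperplane convex_hyperplane)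
    have slice: "K \<inter> h \<noteq> {}" if "convex K" "p \<in> K" "p \<in> A" "q \<in> K" "q \<in> S m" for K p q
      using connected_ivt_hyperplane[OF convex_connected[OF that(1)] that(2,4), of c \<beta>]
        c(1)[OF that(3)] c(2)[OF that(5)] by (auto simp: h_def)
    have eq: "(\<Union>i\<in>I. S i \<inter> h) = (\<Union>i\<in>insert m I. S i) \<inter> h"
      using c(2) by (fastforce simp: h_def)
    have "(\<Inter>i\<in>I. S i \<inter> h) \<noteq> {}"
    proof (rule insert.IH)
      show "compact (S i \<inter> h)" if "i \<in> I" for i
        using insert.prems(1)[of i] that h by (auto intro: compact_Int_closed)
      show "convex (S i \<inter> h)" if "i \<in> I" for i
        using insert.prems(2)[of i] that h by (auto intro: convex_Int)
      show "convex (\<Union>i\<in>I. S i \<inter> h)" unfolding eq using insert.prems(3) h by (intro convex_Int)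
      obtain p q where "p \<in> A" "q \<in> S m" using Ane \<open>S m \<noteq> {}\<close> by blast
      moreover from this have "p \<in> (\<Union>i\<in>insert m I. S i)" "q \<in> (\<Union>i\<in>insert m I. S i)"
        using insert.hyps(2) by (auto simp: A_def)
      ultimately show "(\<Union>i\<in>I. S i \<inter> h) \<noteq> {}"
        unfolding eq using slice[OF insert.prems(3)] by blast
      show "(\<Inter>j\<in>I - {i}. S j \<inter> h) \<noteq> {}" if i: "i \<in> I" for i
      proof -
        have cv: "convex (\<Inter>j\<in>I - {i}. S j)"
          using insert.prems(2) by (auto intro!: convex_INT)
        obtain q where q: "q \<in> S m" "q \<in> (\<Inter>j\<in>I - {i}. S j)" using meets[OF i] by blast
        obtain p where p: "p \<in> A" using Ane by blast
        then have "p \<in> (\<Inter>j\<in>I - {i}. S j)" by (auto simp: A_def)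
        from slice[OF cv this p q(2,1)] show ?thesis by auto
      qed
    qed
    then obtain z where "z \<in> A" "z \<in> h" using insert.hyps(2) by (auto simp: A_def)
    then show False using c(1) by (auto simp: h_def)
  qed
qed

text \<open>By induction the sets indexed by a proper subset of \<open>A\<close> meet inside the convex hull of
  that subset. Hence Klee's theorem applies to the traces of the sets on the convex hull of \<open>A\<close>, which
  is their union.\<close>

lemma convex_KKM:
  fixes S :: "'a \<Rightarrow> 'a::real_inner set"
  assumes "finite A" "A \<noteq> {}"
    and "\<And>y. y \<in> A \<Longrightarrow> closed (S y)" "\<And>y. y \<in> A \<Longrightarrow> convex (S y)"
    and "\<And>J. J \<subseteq> A \<Longrightarrow> convex hull J \<subseteq> (\<Union>y\<in>J. S y)"
  shows "convex hull A \<inter> (\<Inter>y\<in>A. S y) \<noteq> {}"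
  using assms
proof (induction A rule: finite_psubset_induct)
  case (psubset A)
  have cov: "(\<Union>y\<in>A. S y \<inter> convex hull A) = convex hull A"
    using psubset.prems(4)[of A] by auto
  have "(\<Inter>y\<in>A. S y \<inter> convex hull A) \<noteq> {}"
  proof (rule Klee_intersection)
    show "compact (S y \<inter> convex hull A)" if "y \<in> A" for y
      using psubset.prems(2)[OF that] finite_imp_compact_convex_hull[OF psubset.hyps(1)]
      by (simp add: closed_Int_compact)
    show "convex (S y \<inter> convex hull A)" if "y \<in> A" for y
      using psubset.prems(3)[OF that] by (simp add: convex_Int)
    show "(\<Inter>j\<in>A - {i}. S j \<inter> convex hull A) \<noteq> {}" if i: "i \<in> A" for i
    proof (cases "A - {i} = {}")
      case False
      have "convex hull (A - {i}) \<inter> (\<Inter>y\<in>A - {i}. S y) \<noteq> {}"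
      proof (rule psubset.IH)
        show "A - {i} \<subset> A" using i by blast
        show "convex hull J \<subseteq> (\<Union>y\<in>J. S y)" if "J \<subseteq> A - {i}" for J
          using that by (intro psubset.prems(4)) blast
      qed (use False psubset.prems(2,3) in auto)
      moreover have "convex hull (A - {i}) \<subseteq> convex hull A" by (intro hull_mono) blast
      ultimately show ?thesis by blast
    qed simp
  qed (use psubset cov in \<open>simp_all add: convex_hull_eq_empty\<close>)
  then show ?case using psubset.prems(1) by auto
qed

section \<open>The variational inequality\<close>

text \<open>A common point \<open>z \<in> C\<close> of these sets over \<open>y \<in> C\<close> solves the dual (Minty) form of the
  variational inequality, sharpened by the quadratic term that strong pseudo-monotonicity supplies.\<close>

definition minty_ball :: "real \<Rightarrow> ('a::real_inner \<Rightarrow> 'a) \<Rightarrow> 'a \<Rightarrow> 'a set"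
  where "minty_ball k F y = {z. k * (norm (y - z))\<^sup>2 \<le> F y \<bullet> (y - z)}"

text \<open>Completing the square. The quadratic term is what makes the set bounded; without it the set would
  only be a half-space.\<close>

lemma minty_ball_eq_cball:
  fixes F :: "'a::real_inner \<Rightarrow> 'a"
  assumes "0 < k"
  shows "minty_ball k F y = cball (y - (1 / (2 * k)) *\<^sub>R F y) (norm ((1 / (2 * k)) *\<^sub>R F y))"
proof -
  have "k * (norm (y - z))\<^sup>2 \<le> F y \<bullet> (y - z) \<longleftrightarrow>
    norm ((y - (1 / (2 * k)) *\<^sub>R F y) - z) \<le> norm ((1 / (2 * k)) *\<^sub>R F y)" for z
  proof -
    define v where "v = (1 / (2 * k)) *\<^sub>R F y"
    have "F y = (2 * k) *\<^sub>R v" using assms by (simp add: v_def)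
    then have "k * (norm (y - z))\<^sup>2 \<le> F y \<bullet> (y - z) \<longleftrightarrow>
      k * ((y - z) \<bullet> (y - z)) \<le> k * (2 * (v \<bullet> (y - z)))"
      by (simp only: power2_norm_eq_inner inner_scaleR_left mult.assoc mult.left_commute[of 2 k])
    also have "\<dots> \<longleftrightarrow> (y - z) \<bullet> (y - z) \<le> 2 * (v \<bullet> (y - z))" using assms by simp
    also have "\<dots> \<longleftrightarrow> norm ((y - v) - z) \<le> norm v"
      unfolding norm_le by (simp add: inner_diff_left inner_diff_right inner_commute algebra_simps)
    finally show ?thesis unfolding v_def .
  qed
  then show ?thesis
    unfolding minty_ball_def cball_def dist_norm by simp
qed

text \<open>If \<open>x\<close> missed all the balls, strong pseudo-monotonicity would place all of \<open>J\<close>, and with it the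
  convex hull of \<open>J\<close>, in an open half-space whose boundary passes through \<open>x\<close>.\<close>

lemma minty_ball_covers:
  assumes F: "strongly_pseudo_monotone k F"
  shows "convex hull J \<subseteq> (\<Union>y\<in>J. minty_ball k F y)"
proof
  fix x assume x: "x \<in> convex hull J"
  show "x \<in> (\<Union>y\<in>J. minty_ball k F y)"
  proof (rule ccontr)
    assume neg: "x \<notin> (\<Union>y\<in>J. minty_ball k F y)"
    have "F x \<bullet> (y - x) < 0" if "y \<in> J" for y
      using F neg that unfolding strongly_pseudo_monotone_def minty_ball_def
      by (smt (verit, ccfv_threshold) UN_iff mem_Collect_eq)
    then have "J \<subseteq> {z. F x \<bullet> z < F x \<bullet> x}" by (auto simp: inner_diff_right)
    then have "convex hull J \<subseteq> {z. F x \<bullet> z < F x \<bullet> x}"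
      by (intro hull_minimal convex_halfspace_lt)
    with x show False by auto
  qed
qed

text \<open>Test the dual inequality at points of the segment from \<open>p\<close> to \<open>y\<close>, divide by the distance
  travelled, and let them tend to \<open>p\<close>.\<close>

lemma minty_imp_VI:
  fixes F :: "'a::real_inner \<Rightarrow> 'a"
  assumes C: "convex C" and L: "L-lipschitz_on UNIV F" and p: "p \<in> C"
    and minty: "\<And>y. y \<in> C \<Longrightarrow> 0 \<le> F y \<bullet> (y - p)"
  shows "p \<in> VI C F"
proof -
  have "0 \<le> F p \<bullet> (y - p)" if y: "y \<in> C" for y
  proof -
    let ?z = "\<lambda>n. p + (1 / real (Suc n)) *\<^sub>R (y - p)"
    have "0 \<le> F (?z n) \<bullet> (y - p)" for n
    proof -
      have "?z n = (1 - 1 / real (Suc n)) *\<^sub>R p + (1 / real (Suc n)) *\<^sub>R y"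
        by (simp add: algebra_simps)
      also have "\<dots> \<in> C" using C p y by (intro convexD_alt) auto
      finally have "0 \<le> F (?z n) \<bullet> (?z n - p)" by (rule minty)
      then show ?thesis by (simp add: zero_le_divide_iff)
    qed
    moreover have "(\<lambda>n. F (?z n) \<bullet> (y - p)) \<longlonglongrightarrow> F p \<bullet> (y - p)"
    proof -
      have "?z \<longlonglongrightarrow> p + 0 *\<^sub>R (y - p)"
        using LIMSEQ_inverse_real_of_nat by (intro tendsto_intros) (simp add: inverse_eq_divide)
      then have "(\<lambda>n. F (?z n)) \<longlonglongrightarrow> F p"
        using lipschitz_on_continuous_on[OF L]
        by (intro isCont_tendsto_compose[of p F]) (auto simp: continuous_on_eq_continuous_at)
      then show ?thesis by (intro tendsto_intros)
    qed
    ultimately show ?thesis by (intro LIMSEQ_le_const) auto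
  qed
  then show ?thesis using p by (simp add: VI_def)
qed

lemma VI_unique:
  assumes F: "strongly_pseudo_monotone k F" and p: "p \<in> VI C F" and q: "q \<in> VI C F"
  shows "p = q"
proof -
  have k: "0 < k" using F by (simp add: strongly_pseudo_monotone_def)
  have "k * (norm (q - p))\<^sup>2 \<le> F q \<bullet> (q - p)" "0 \<le> F q \<bullet> (p - q)"
    using F p q by (auto simp: strongly_pseudo_monotone_def VI_def)
  then have "k * (norm (q - p))\<^sup>2 \<le> 0" by (simp add: inner_diff_right)
  then show ?thesis using k by (simp add: mult_le_0_iff)
qed

lemma VI_singleton:
  fixes C :: "'a::{real_inner,complete_space} set"
  assumes C: "C \<noteq> {}" "closed C" "convex C"
    and F: "strongly_pseudo_monotone k F" and L: "L-lipschitz_on UNIV F"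
  obtains p where "VI C F = {p}"
proof -
  have k: "0 < k" using F by (simp add: strongly_pseudo_monotone_def)
  define S where "S y = C \<inter> minty_ball k F y" for y
  have S: "closed (S y)" "convex (S y)" "bounded (S y)" for y
    using C by (auto simp: S_def minty_ball_eq_cball[OF k] convex_Int bounded_Int)
  obtain y0 where y0: "y0 \<in> C" using C(1) by blast
  have "\<Inter>(S ` C) \<noteq> {}"
  proof (rule bounded_convex_finite_intersection_property[of _ "S y0"])
    fix \<F> assume "finite \<F>" "\<F> \<subseteq> S ` C"
    then obtain A where A: "A \<subseteq> C" "finite A" "\<F> = S ` A" using finite_subset_image by metis
    show "\<Inter>\<F> \<noteq> {}"
    proof (cases "A = {}")
      case False
      have "convex hull A \<inter> (\<Inter>y\<in>A. minty_ball k F y) \<noteq> {}"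
        using A(2) False minty_ball_covers[OF F]
        by (intro convex_KKM) (auto simp: minty_ball_eq_cball[OF k])
      moreover have "convex hull A \<subseteq> C" using A(1) C(3) by (intro hull_minimal)
      ultimately show ?thesis using A(3) False by (auto simp: S_def)
    qed (simp add: A)
  qed (use S y0 in auto)
  then obtain p where p: "\<And>y. y \<in> C \<Longrightarrow> p \<in> S y" by blast
  have "p \<in> VI C F"
  proof (rule minty_imp_VI[OF C(3) L])
    show "p \<in> C" using p[OF y0] by (simp add: S_def)
    show "0 \<le> F y \<bullet> (y - p)" if "y \<in> C" for y
    proof -
      have "k * (norm (y - p))\<^sup>2 \<le> F y \<bullet> (y - p)" using p[OF that] by (simp add: S_def minty_ball_def)
      moreover have "0 \<le> k * (norm (y - p))\<^sup>2" using k by simp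
      ultimately show ?thesis by linarith
    qed
  qed
  then show thesis using that VI_unique[OF F] by blast
qed

section \<open>Linear convergence\<close>

text \<open>The solution lies in the half-space \<open>T\<close>, so the projection inequality bounds
  \<open>\<parallel>u - p\<parallel>\<^sup>2\<close>. Completing the square there with \<open>d *\<^sub>R \<eta>\<close> cancels the unknown \<open>u\<close>: the step
  length \<open>d\<close> is chosen so that \<open>d * \<parallel>\<eta>\<parallel>\<^sup>2 = (w - y) \<bullet> \<eta>\<close>. What is left is a gain of at least \<open>m\<close> times
  \<open>\<parallel>w - y\<parallel>\<^sup>2 + \<parallel>y - p\<parallel>\<^sup>2\<close>, where \<open>m\<close> is the minimum in \<open>t\<close>: its first entry comes from the
  Lipschitz bounds on \<open>\<eta>\<close>, its second from strong pseudo-monotonicity at \<open>p\<close>. Finally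
  \<open>\<parallel>w - p\<parallel>\<^sup>2\<close> is at most twice that sum, whence the factor \<open>1/2\<close> in \<open>t\<close>.\<close>

lemma subgradient_extragradient_step_contracts:
  fixes C :: "'a::{real_inner,complete_space} set"
  assumes C: "closed C" "convex C" and p: "p \<in> VI C F"
    and F: "strongly_pseudo_monotone k F" and L: "L-lipschitz_on UNIV F"
    and lam: "0 < lam" "lam * L < 1"
    and y: "y = metric_proj C (w - lam *\<^sub>R F w)"
    and T: "T = {z. (w - lam *\<^sub>R F w - y) \<bullet> (z - y) \<le> 0}"
    and \<eta>: "\<eta> = w - y - lam *\<^sub>R (F w - F y)" "\<eta> \<noteq> 0"
    and d: "d = ((w - y) \<bullet> \<eta>) / (norm \<eta>)\<^sup>2"
    and u: "u = metric_proj T (w - (lam * d) *\<^sub>R F y)"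
    and t: "t = 1 - 1/2 * min ((1 - lam * L)\<^sup>2 / (1 + lam * L)\<^sup>2)
                             (2 * lam * k * ((1 - lam * L) / (1 + lam * L)\<^sup>2))"
  shows "(norm (u - p))\<^sup>2 \<le> t * (norm (w - p))\<^sup>2"
proof -
  have k: "0 < k" using F by (simp add: strongly_pseudo_monotone_def)
  have L0: "0 \<le> L" using L by (rule lipschitz_on_nonneg)
  have pC: "p \<in> C" using p by (simp add: VI_def)
  then have Cne: "C \<noteq> {}" by blast
  have yC: "y \<in> C" and pT: "p \<in> T"
    unfolding T y using metric_proj_variational[OF C Cne] pC by auto
  have "T = {z. (w - lam *\<^sub>R F w - y) \<bullet> z \<le> (w - lam *\<^sub>R F w - y) \<bullet> y}"
    unfolding T by (simp add: inner_diff_right)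
  then have Tcc: "closed T" "convex T" by (simp_all add: closed_halfspace_le convex_halfspace_le)
  have uT: "u \<in> T" and up: "(w - (lam * d) *\<^sub>R F y - u) \<bullet> (p - u) \<le> 0"
    unfolding u using metric_proj_variational[OF Tcc] pT by auto

  define r where "r = norm (w - y)"
  have lip: "norm (lam *\<^sub>R (F w - F y)) \<le> lam * L * r"
    using lipschitz_onD[OF L, of w y] lam(1) by (simp add: dist_norm r_def mult.assoc)
  have eta_ub: "norm \<eta> \<le> (1 + lam * L) * r"
    using norm_triangle_ineq4[of "w - y" "lam *\<^sub>R (F w - F y)"] lip
    unfolding \<eta>(1) r_def[symmetric] by (simp add: algebra_simps)
  have eta_lb: "(1 - lam * L) * r\<^sup>2 \<le> (w - y) \<bullet> \<eta>"
  proof -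
    have "(w - y) \<bullet> (lam *\<^sub>R (F w - F y)) \<le> r * (lam * L * r)"
      using norm_cauchy_schwarz[of "w - y" "lam *\<^sub>R (F w - F y)"] lip
        mult_left_mono[OF lip, of r] by (simp add: r_def)
    moreover have "(w - y) \<bullet> \<eta> = r\<^sup>2 - (w - y) \<bullet> (lam *\<^sub>R (F w - F y))"
      unfolding \<eta>(1) inner_diff_right[of "w - y" "w - y"] by (simp add: r_def power2_norm_eq_inner)
    ultimately show ?thesis by (simp add: power2_eq_square algebra_simps)
  qed
  have "0 < norm \<eta>" using \<eta>(2) by simp
  then have r: "0 < r" using eta_ub by (cases "r = 0") (auto simp: r_def)
  let ?g = "(1 - lam * L) / (1 + lam * L)\<^sup>2"
  have pos: "0 < 1 - lam * L" "0 < 1 + lam * L" using lam L0 by (auto simp: add_pos_nonneg)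
  have dlb: "?g \<le> d"
  proof -
    have "?g = ((1 - lam * L) * r\<^sup>2) / ((1 + lam * L) * r)\<^sup>2"
      using r by (simp add: power_mult_distrib)
    also have "\<dots> \<le> d" unfolding d
    proof (rule frac_le)
      show "(norm \<eta>)\<^sup>2 \<le> ((1 + lam * L) * r)\<^sup>2" using eta_ub by (intro power_mono) auto
      show "0 \<le> (w - y) \<bullet> \<eta>" using eta_lb pos(1) by (smt (verit) mult_nonneg_nonneg zero_le_power2)
    qed (use eta_lb \<open>0 < norm \<eta>\<close> in auto)
    finally show ?thesis .
  qed
  have d0: "0 \<le> d" using dlb pos by (smt (verit) divide_nonneg_nonneg zero_le_power2)

  have upper: "(norm (u - p))\<^sup>2 \<le> (norm (w - p))\<^sup>2 - d * ((w - y) \<bullet> \<eta>) - 2 * lam * d * (F y \<bullet> (y - p))"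
  proof -
    have de: "d * (\<eta> \<bullet> \<eta>) = (w - y) \<bullet> \<eta>"
      using \<eta>(2) by (simp add: d power2_norm_eq_inner)
    have a: "(norm (u - p))\<^sup>2 \<le> (norm (w - p))\<^sup>2 - (norm (w - u))\<^sup>2 - 2 * (lam * d) * (F y \<bullet> (u - p))"
      using up unfolding power2_norm_eq_inner
      by (simp add: algebra_simps inner_simps inner_commute)
    \<comment> \<open>This is where \<open>u \<in> T\<close> enters; its multiple by 2 is added to the bound \<open>a\<close>.\<close>
    have b: "0 \<le> - d * ((w - lam *\<^sub>R F w - y) \<bullet> (u - y))"
      using uT d0 unfolding T by (simp add: mult_le_0_iff)
    have e: "w - lam *\<^sub>R F w - y = \<eta> - lam *\<^sub>R F y"
      unfolding \<eta>(1) by (simp add: algebra_simps)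
    have c: "0 \<le> (norm ((w - u) - d *\<^sub>R \<eta>))\<^sup>2" by simp
    have c': "(norm ((w - u) - d *\<^sub>R \<eta>))\<^sup>2 = (norm (w - u))\<^sup>2 - 2 * d * ((w - u) \<bullet> \<eta>) + d * ((w - y) \<bullet> \<eta>)"
      unfolding de[symmetric] power2_norm_eq_inner
      by (simp add: algebra_simps inner_simps inner_commute)
    show ?thesis using a b c unfolding e c'
      by (simp add: algebra_simps inner_simps inner_commute)
  qed
  have "k * (norm (y - p))\<^sup>2 \<le> F y \<bullet> (y - p)"
    using F p yC by (auto simp: strongly_pseudo_monotone_def VI_def)
  then have "2 * lam * d * (k * (norm (y - p))\<^sup>2) \<le> 2 * lam * d * (F y \<bullet> (y - p))"
    using lam(1) d0 by (intro mult_left_mono) auto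
  moreover have "?g * ((1 - lam * L) * r\<^sup>2) \<le> d * ((w - y) \<bullet> \<eta>)"
    using dlb eta_lb pos d0 by (intro mult_mono) auto
  moreover have "2 * lam * ?g * (k * (norm (y - p))\<^sup>2) \<le> 2 * lam * d * (k * (norm (y - p))\<^sup>2)"
    using dlb lam(1) k by (intro mult_right_mono mult_left_mono) auto
  moreover define m where "m = min ((1 - lam * L)\<^sup>2 / (1 + lam * L)\<^sup>2) (2 * lam * k * ?g)"
  have "m * r\<^sup>2 \<le> ?g * ((1 - lam * L) * r\<^sup>2)"
  proof -
    have "m * r\<^sup>2 \<le> (1 - lam * L)\<^sup>2 / (1 + lam * L)\<^sup>2 * r\<^sup>2"
      by (intro mult_right_mono) (auto simp: m_def)
    then show ?thesis by (simp add: power2_eq_square)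
  qed
  moreover have "m * (norm (y - p))\<^sup>2 \<le> 2 * lam * ?g * (k * (norm (y - p))\<^sup>2)"
  proof -
    have "m * (norm (y - p))\<^sup>2 \<le> 2 * lam * k * ?g * (norm (y - p))\<^sup>2"
      by (intro mult_right_mono) (auto simp: m_def)
    then show ?thesis by (simp add: mult_ac)
  qed
  moreover have "m / 2 * (norm (w - p))\<^sup>2 \<le> m * r\<^sup>2 + m * (norm (y - p))\<^sup>2"
  proof -
    have "0 \<le> m" using pos lam(1) k by (auto simp: m_def)
    moreover have "(norm (w - p))\<^sup>2 \<le> 2 * (r\<^sup>2 + (norm (y - p))\<^sup>2)"
      using parallelogram_midpoint[of w p y] by (simp add: r_def dist_norm norm_minus_commute)
    ultimately have "m / 2 * (norm (w - p))\<^sup>2 \<le> m / 2 * (2 * (r\<^sup>2 + (norm (y - p))\<^sup>2))"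
      by (intro mult_left_mono) auto
    then show ?thesis by (simp add: algebra_simps)
  qed
  ultimately have "(norm (u - p))\<^sup>2 \<le> (norm (w - p))\<^sup>2 - m / 2 * (norm (w - p))\<^sup>2"
    using upper by linarith
  then show ?thesis unfolding t m_def[symmetric] by (simp add: algebra_simps)
qed

lemma norm_sq_affine_combination:
  fixes a b :: "'a::real_inner"
  shows "(norm ((1 - s) *\<^sub>R a + s *\<^sub>R b))\<^sup>2 =
    (1 - s) * (norm a)\<^sup>2 + s * (norm b)\<^sup>2 - s * (1 - s) * (norm (a - b))\<^sup>2"
  unfolding power2_norm_eq_inner
  by (simp add: algebra_simps inner_simps inner_commute power2_eq_square)

text \<open>Here \<open>a\<close>, \<open>b\<close>, \<open>c\<close> are consecutive iterates and \<open>v\<close> is the extragradient point. Expanding both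
  affine combinations leaves the error term \<open>\<alpha> * t * nu * (1 + nu) * \<parallel>b - a\<parallel>\<^sup>2\<close>, which is at most
  \<open>\<parallel>b - a\<parallel>\<^sup>2 / 3\<close>, and the gain \<open>\<alpha> * (1 - \<alpha>) * \<parallel>b - v\<parallel>\<^sup>2\<close>. As \<open>\<alpha> < 1/3\<close>, the gain is at
  least \<open>2 * \<parallel>c - b\<parallel>\<^sup>2\<close>. The weight 2 in the energy is therefore affordable, and it turns the error
  coefficient \<open>1/3\<close> into the ratio \<open>1/6\<close>.\<close>

lemma inertial_relaxation_energy_decay:
  fixes a b v p :: "'a::real_inner"
  assumes t: "0 < t" and nu: "0 \<le> nu" "nu < 1 / t - 1" and \<alpha>: "0 < \<alpha>" "\<alpha> < 1 / 3"
    and v: "(norm (v - p))\<^sup>2 \<le> t * (norm (b + nu *\<^sub>R (b - a) - p))\<^sup>2"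
    and q: "q = max (1 - \<alpha> * (1 - t * (1 + nu))) (1/6)"
    and c: "c = (1 - \<alpha>) *\<^sub>R b + \<alpha> *\<^sub>R v"
    and nu1: "nu \<le> 1"
  shows "(norm (c - p))\<^sup>2 + 2 * (norm (c - b))\<^sup>2 \<le> q * ((norm (b - p))\<^sup>2 + 2 * (norm (b - a))\<^sup>2)"
proof -
  define A B D E where "A = (norm (a - p))\<^sup>2" "B = (norm (b - p))\<^sup>2" "D = (norm (b - a))\<^sup>2"
    "E = (norm (b - v))\<^sup>2"
  note defs = this
  have nn: "0 \<le> A" "0 \<le> B" "0 \<le> D" "0 \<le> E" by (simp_all add: defs)
  have tn: "t * (1 + nu) < 1" using nu(2) t by (simp add: field_simps)
  have w: "(norm (b + nu *\<^sub>R (b - a) - p))\<^sup>2 = (1 + nu) * B - nu * A + nu * (1 + nu) * D"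
  proof -
    \<comment> \<open>Extrapolation is an affine combination with the negative weight \<open>-nu\<close>.\<close>
    have "b + nu *\<^sub>R (b - a) - p = (1 - (- nu)) *\<^sub>R (b - p) + (- nu) *\<^sub>R (a - p)"
      by (simp add: algebra_simps)
    then show ?thesis using norm_sq_affine_combination[of "- nu" "b - p" "a - p"]
      by (simp add: defs algebra_simps)
  qed
  have "c - p = (1 - \<alpha>) *\<^sub>R (b - p) + \<alpha> *\<^sub>R (v - p)" unfolding c by (simp add: algebra_simps)
  then have cp: "(norm (c - p))\<^sup>2 = (1 - \<alpha>) * B + \<alpha> * (norm (v - p))\<^sup>2 - \<alpha> * (1 - \<alpha>) * E"
    using norm_sq_affine_combination[of \<alpha> "b - p" "v - p"] by (simp add: defs)
  have "c - b = (- \<alpha>) *\<^sub>R (b - v)" unfolding c by (simp add: algebra_simps)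
  then have cb: "(norm (c - b))\<^sup>2 = \<alpha>\<^sup>2 * E" by (simp add: defs power_mult_distrib)
  have "\<alpha> * (norm (v - p))\<^sup>2 \<le> \<alpha> * (t * ((1 + nu) * B - nu * A + nu * (1 + nu) * D))"
    using v \<alpha> unfolding w by (intro mult_left_mono) auto
  moreover have "\<alpha> * (t * (nu * A)) \<ge> 0" using \<alpha> t nu nn by simp
  moreover have "\<alpha> * (nu * (t * (1 + nu)) * D) \<le> 1/3 * D"
  proof -
    have "nu * (t * (1 + nu)) \<le> 1 * 1" using nu1 nu(1) t tn by (intro mult_mono) auto
    then have "\<alpha> * (nu * (t * (1 + nu))) \<le> 1/3 * 1"
      using \<alpha> nu t by (intro mult_mono) auto
    then show ?thesis using mult_right_mono[OF _ nn(3)] by fastforce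
  qed
  moreover have "2 * (\<alpha>\<^sup>2 * E) \<le> \<alpha> * (1 - \<alpha>) * E"
  proof -
    have "\<alpha> * (2 * \<alpha>) \<le> \<alpha> * (1 - \<alpha>)" using \<alpha> by (intro mult_left_mono) auto
    from mult_right_mono[OF this nn(4)] show ?thesis by (simp add: power2_eq_square mult_ac)
  qed
  ultimately have "(norm (c - p))\<^sup>2 + 2 * (norm (c - b))\<^sup>2 \<le>
      (1 - \<alpha> * (1 - t * (1 + nu))) * B + 1/3 * D"
    unfolding cp cb by (simp add: algebra_simps)
  also have "\<dots> \<le> q * B + q * (2 * D)"
  proof (rule add_mono)
    show "(1 - \<alpha> * (1 - t * (1 + nu))) * B \<le> q * B" using nn by (intro mult_right_mono) (auto simp: q)
    have "1/6 * (2 * D) \<le> q * (2 * D)" using nn by (intro mult_right_mono) (auto simp: q)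
    then show "1/3 * D \<le> q * (2 * D)" by simp
  qed
  finally show ?thesis by (simp add: defs algebra_simps)
qed

theorem theorem4p4:
  fixes C :: "'a::{real_inner,complete_space} set"
    and F :: "'a \<Rightarrow> 'a"
    and k L lam nu \<alpha> t :: real
    and x w y u \<eta> :: "nat \<Rightarrow> 'a"
    and T :: "nat \<Rightarrow> 'a set"
    and d :: "nat \<Rightarrow> real"
  assumes C: "C \<noteq> {}" "closed C" "convex C"
    and B1: "strongly_pseudo_monotone k F" "0 < L" "L-lipschitz_on UNIV F"
    and B2: "lam \<in> {0<..<1 / L}"
    and t: "t = 1 - 1/2 * min ((1 - lam * L)\<^sup>2 / (1 + lam * L)\<^sup>2)
                             (2 * lam * k * ((1 - lam * L) / (1 + lam * L)\<^sup>2))"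
    and B3: "0 \<le> nu" "nu < 1 / t - 1"
    and B4: "0 < \<alpha>" "\<alpha> < 1 / 3"
    and iter: "linear_inertial_subgradient_extragradient C F lam nu \<alpha> x w y u T \<eta> d"
    and well_defined: "\<And>n. n \<ge> 1 \<Longrightarrow> \<eta> n \<noteq> 0"
  shows "\<exists>p. VI C F = {p} \<and>
           (\<exists>M q. 0 \<le> M \<and> 0 < q \<and> q < 1 \<and> (\<forall>n\<ge>1. norm (x n - p) \<le> M * q ^ n))"
proof -
  have k: "0 < k" using B1(1) by (simp add: strongly_pseudo_monotone_def)
  have lam: "0 < lam" "lam * L < 1" using B2 B1(2) by (auto simp: field_simps)
  have t01: "0 < t" "t < 1"
    using inertial_parameter_in_unit_interval[OF k B1(2) B2 t] by auto
  \<comment> \<open>The minimum in \<open>t\<close> is at most 1, so \<open>t \<ge> 1/2\<close>, and the bound on \<open>nu\<close> forces \<open>nu \<le> 1\<close>.\<close>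
  have nu1: "nu \<le> 1"
  proof -
    have "1 - lam * L \<le> 1 + lam * L" using lam(1) B1(2) by simp
    then have "(1 - lam * L)\<^sup>2 \<le> (1 + lam * L)\<^sup>2" using lam(2) by (intro power_mono) auto
    then have "(1 - lam * L)\<^sup>2 / (1 + lam * L)\<^sup>2 \<le> 1" by (simp add: divide_le_eq_1)
    then have "1 / 2 \<le> t" unfolding t by linarith
    then have "1 / t \<le> 2" using t01 by (simp add: field_simps)
    then show ?thesis using B3(2) by linarith
  qed
  obtain p where p: "VI C F = {p}" using VI_singleton[OF C B1(1,3)] .
  define q where "q = max (1 - \<alpha> * (1 - t * (1 + nu))) (1/6)"
  have q: "0 < q" "q < 1"
  proof -
    have "t * (1 + nu) < 1" using B3(2) t01 by (simp add: field_simps)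
    then show "0 < q" "q < 1" using B4 by (auto simp: q_def)
  qed
  define E where "E n = (norm (x n - p))\<^sup>2 + 2 * (norm (x n - x (n - 1)))\<^sup>2" for n
  have step: "E (n + 1) \<le> q * E n" if n: "n \<ge> 1" for n
  proof -
    note it = iter[unfolded linear_inertial_subgradient_extragradient_def, rule_format, OF n]
    have "(norm (u n - p))\<^sup>2 \<le> t * (norm (w n - p))\<^sup>2"
      by (rule subgradient_extragradient_step_contracts[OF C(2,3) _ B1(1,3) lam _ _ _ well_defined[OF n] _ _ t])
        (use it p in auto)
    then have "(norm (u n - p))\<^sup>2 \<le> t * (norm (x n + nu *\<^sub>R (x n - x (n - 1)) - p))\<^sup>2"
      using it by simp
    from inertial_relaxation_energy_decay[OF t01(1) B3 B4 this q_def _ nu1, of "x (n + 1)"]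
    show ?thesis using it by (simp add: E_def)
  qed
  have E: "E (Suc n) \<le> q ^ n * E 1" for n
  proof (induction n)
    case (Suc n)
    have "E (Suc (Suc n)) \<le> q * E (Suc n)" using step[of "Suc n"] by simp
    also have "\<dots> \<le> q * (q ^ n * E 1)" using Suc q by (intro mult_left_mono) auto
    finally show ?case by simp
  qed simp
  \<comment> \<open>The decay starts at index 1, which the constant offsets by the division by \<open>q\<close>.\<close>
  have "norm (x n - p) \<le> sqrt (E 1 / q) * sqrt q ^ n" if "n \<ge> 1" for n
  proof -
    have "\<exists>j. n = Suc j" using that by presburger
    then obtain j where j: "n = Suc j" by blast
    have "(norm (x n - p))\<^sup>2 \<le> E n" by (simp add: E_def)
    also have "\<dots> \<le> E 1 / q * q ^ n" using E[of j] q by (simp add: j mult.commute)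
    finally have "norm (x n - p) \<le> sqrt (E 1 / q * q ^ n)" by (rule real_le_rsqrt)
    also have "\<dots> = sqrt (E 1 / q) * sqrt (q ^ n)" by (rule real_sqrt_mult)
    also have "sqrt (q ^ n) = sqrt q ^ n" by (rule real_sqrt_power)
    finally show ?thesis .
  qed
  moreover have "0 \<le> sqrt (E 1 / q)" using q by (simp add: E_def)
  moreover have "0 < sqrt q" "sqrt q < 1" using q by auto
  ultimately show ?thesis using p by blast
qed

end
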